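(* Let $n\ge 2$. Among all trees $T$ of order $n$ and all vertices $r\in V(T)$, the minimum value of $CC(r)$ is $2n^2-6n+5$, and it is attained when $T$ is a star and $r$ is one of its leaves.
   Context: The simple random walk moves at each step to a uniformly random neighbour; $H_{vw}$ is the expected number of steps for the walk started at $v$ to first reach $w$ ($H_{vv}=0$). The cover cost is $CC(r)=\sum_{w\in V(T)} H_{rw}$. *)

theory Defs
  imports "HOL-Probability.Probability" "Graph_Theory.Graph_Theory"
begin

text \<open>
  Finite simple undirected graphs are symmetric, loop-free finite digraphs (\<^locale>\<open>pair_graph\<close>),
  an undirected edge being represented by its two orientations. The library's predicate
  \<^const>\<open>tree\<close> does not fit this representation: it already counts \<open>u \<rightarrow> v \<rightarrow> u\<close> as a cycle.
  An undirected cycle is a cycle with at least three arcs.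
\<close>

definition undirected_tree :: "'a pair_pre_digraph \<Rightarrow> bool" where
  "undirected_tree G \<longleftrightarrow> pair_graph G \<and> connected (with_proj G) \<and>
     (\<nexists>p. pre_digraph.cycle (with_proj G) p \<and> 3 \<le> length p)"

definition star :: "'a pair_pre_digraph \<Rightarrow> bool" where
  "star G \<longleftrightarrow> finite (pverts G) \<and>
     (\<exists>c\<in>pverts G. parcs G = {c} \<times> (pverts G - {c}) \<union> (pverts G - {c}) \<times> {c})"

definition leaf :: "'a pair_pre_digraph \<Rightarrow> 'a \<Rightarrow> bool" where
  "leaf G r \<longleftrightarrow> r \<in> pverts G \<and> out_degree (with_proj G) r = 1"

definition neighbours :: "'a pair_pre_digraph \<Rightarrow> 'a \<Rightarrow> 'a set" where
  "neighbours G u = {v. (u, v) \<in> parcs G}"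

text \<open>
  Conditional law of the position at time \<open>i\<close> given the trajectory \<open>\<omega>\<close> up to time \<open>i - 1\<close>.
  At an isolated vertex it is an arbitrary distribution (\<^const>\<open>pmf_of_set\<close> of the empty set);
  trees with at least two vertices have none.
\<close>

definition srw_kernel :: "'a pair_pre_digraph \<Rightarrow> 'a \<Rightarrow> nat \<Rightarrow> (nat \<Rightarrow> 'a) \<Rightarrow> 'a measure" where
  "srw_kernel G v i \<omega> =
     measure_pmf (if i = 0 then return_pmf v else pmf_of_set (neighbours G (\<omega> (i - 1))))"

lemma Ionescu_Tulcea_srw_kernel: "Ionescu_Tulcea (srw_kernel G v) (\<lambda>_. count_space UNIV)"
proof (rule Ionescu_Tulcea.intro)
  show "srw_kernel G v i \<in> measurable (PiM {0..<i} (\<lambda>_. count_space UNIV))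
          (subprob_algebra (count_space UNIV))" for i
  proof (cases i)
    case 0
    then show ?thesis
      by (simp add: srw_kernel_def [abs_def] measure_pmf_in_subprob_algebra)
  next
    case (Suc j)
    have "(\<lambda>\<omega>. \<omega> j) \<in> measurable (PiM {0..<i} (\<lambda>_. count_space UNIV)) (count_space UNIV)"
      by (rule measurable_component_singleton) (simp add: Suc)
    moreover have "(\<lambda>u. measure_pmf (pmf_of_set (neighbours G u)))
        \<in> measurable (count_space UNIV) (subprob_algebra (count_space UNIV))"
      by (simp add: measure_pmf_in_subprob_algebra)
    ultimately show ?thesis
      using measurable_compose by (fastforce simp: srw_kernel_def [abs_def] Suc)
  qed
  show "prob_space (srw_kernel G v i x)" for i x
    by (simp add: srw_kernel_def measure_pmf.prob_space_axioms)
qed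

text \<open>The law on trajectories of the simple random walk started at \<open>v\<close> (Ionescu-Tulcea extension).\<close>

definition srw :: "'a pair_pre_digraph \<Rightarrow> 'a \<Rightarrow> (nat \<Rightarrow> 'a) measure" where
  "srw G v = projective_family.lim UNIV
     (Ionescu_Tulcea.CI (srw_kernel G v) (\<lambda>_. count_space UNIV)) (\<lambda>_. count_space UNIV)"

definition first_hit :: "'a \<Rightarrow> (nat \<Rightarrow> 'a) \<Rightarrow> ennreal" where
  "first_hit w \<omega> = (INF t\<in>{t. \<omega> t = w}. of_nat t)"

definition hitting_time :: "'a pair_pre_digraph \<Rightarrow> 'a \<Rightarrow> 'a \<Rightarrow> ennreal" where
  "hitting_time G v w = (\<integral>\<^sup>+\<omega>. first_hit w \<omega> \<partial>srw G v)"

definition cover_cost :: "'a pair_pre_digraph \<Rightarrow> 'a \<Rightarrow> ennreal" where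
  "cover_cost G r = (\<Sum>w\<in>pverts G. hitting_time G r w)"

text \<open>Sanity check: the finite-dimensional distributions of the walk.\<close>

lemma emeasure_srw_cylinder:
  "emeasure (srw G v) {\<omega>. \<forall>i\<le>n. \<omega> i = x i} =
     indicator {v} (x 0) *
     (\<Prod>i<n. ennreal (pmf (pmf_of_set (neighbours G (x i))) (x (Suc i))))"
proof -
  interpret IT: Ionescu_Tulcea "srw_kernel G v" "\<lambda>_. count_space UNIV"
    by (rule Ionescu_Tulcea_srw_kernel)
  let ?M = "\<lambda>_::nat. count_space (UNIV :: 'a set)"
  let ?A = "\<lambda>n. PiE {0..<n} (\<lambda>i. {x i})"
  have A [measurable]: "?A n \<in> sets (PiM {0..<n} ?M)" for n
    by (intro sets_PiM_I_finite) auto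
  have C: "emeasure (IT.C 0 (Suc n) (\<lambda>_. undefined)) (?A (Suc n)) =
     indicator {v} (x 0) *
     (\<Prod>i<n. ennreal (pmf (pmf_of_set (neighbours G (x i))) (x (Suc i))))" for n
  proof -
    have u: "(\<lambda>_. undefined) \<in> space (PiM {0..<0} ?M)" by (simp add: space_PiM)
    have step: "emeasure (IT.C 0 (Suc m) (\<lambda>_. undefined)) (?A (Suc m)) =
       emeasure (IT.C 0 m (\<lambda>_. undefined)) (?A m) *
       emeasure (srw_kernel G v m (\<lambda>i\<in>{0..<m}. x i)) {x m}" for m
    proof -
      have "emeasure (IT.C 0 (Suc m) (\<lambda>_. undefined)) (?A (Suc m)) =
         (\<integral>\<^sup>+\<omega>. emeasure (IT.eP m \<omega>) (?A (Suc m)) \<partial>IT.C 0 m (\<lambda>_. undefined))"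
        using IT.measurable_eP[of m] IT.sets_C[OF u, of m] IT.space_C[OF u, of m]
        by (simp, subst emeasure_bind[where N="PiM {0..<Suc m} ?M"])
           (auto simp: measurable_cong_sets[OF IT.sets_C[OF u]] A)
      also have "\<dots> = (\<integral>\<^sup>+\<omega>. emeasure (srw_kernel G v m (\<lambda>i\<in>{0..<m}. x i)) {x m} *
          indicator (?A m) \<omega> \<partial>IT.C 0 m (\<lambda>_. undefined))"
      proof (rule nn_integral_cong)
        fix \<omega> assume "\<omega> \<in> space (IT.C 0 m (\<lambda>_. undefined))"
        then have w: "\<omega> \<in> space (PiM {0..<m} ?M)" using IT.space_C[OF u, of m] by simp
        then have ext: "\<omega> \<in> extensional {0..<m}" by (simp add: space_PiM PiE_def)
        have *: "emeasure (IT.eP m \<omega>) (?A (Suc m)) =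
           emeasure (srw_kernel G v m \<omega>) ((\<lambda>y. fun_upd \<omega> m y) -` ?A (Suc m) \<inter> UNIV)"
          using IT.emeasure_eP[OF w A[of "Suc m"]] by simp
        show "emeasure (IT.eP m \<omega>) (?A (Suc m)) =
          emeasure (srw_kernel G v m (\<lambda>i\<in>{0..<m}. x i)) {x m} * indicator (?A m) \<omega>"
        proof (cases "\<omega> \<in> ?A m")
          case True
          then have eq: "\<omega> = (\<lambda>i\<in>{0..<m}. x i)"
            by (auto simp: PiE_def extensional_def fun_eq_iff)
          have "(\<lambda>y. fun_upd \<omega> m y) -` ?A (Suc m) = {x m}"
            unfolding eq by (auto simp: PiE_iff extensional_def less_Suc_eq dest!: bspec[of "{0..<Suc m}" _ m])
          with * True eq show ?thesis by simp
        next
          case False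
          then obtain i where "i < m" "\<omega> i \<noteq> x i" using ext by (auto simp: PiE_iff)
          then have "(\<lambda>y. fun_upd \<omega> m y) -` ?A (Suc m) = {}"
            by (auto simp: PiE_iff dest!: bspec[of _ _ i])
          with * False show ?thesis by simp
        qed
      qed
      also have "\<dots> = emeasure (srw_kernel G v m (\<lambda>i\<in>{0..<m}. x i)) {x m} *
          emeasure (IT.C 0 m (\<lambda>_. undefined)) (?A m)"
        using IT.sets_C[OF u, of m] A[of m] by (simp add: nn_integral_cmult_indicator)
      finally show ?thesis by (simp add: mult.commute)
    qed
    show ?thesis
    proof (induction n)
      case 0
      have "emeasure (IT.C 0 0 (\<lambda>_. undefined)) (?A 0) = 1"
        using A[of 0] by (simp add: emeasure_return)
      then show ?case
        by (subst step)
           (auto simp: srw_kernel_def emeasure_pmf_single pmf_return indicator_def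
             simp del: IT.C.simps)
    next
      case (Suc n)
      show ?case
        by (subst step, subst Suc)
           (simp add: srw_kernel_def emeasure_pmf_single mult.assoc)
    qed
  qed
  have "{\<omega>. \<forall>i\<le>n. \<omega> i = x i} = prod_emb UNIV ?M {0..<Suc n} (?A (Suc n))"
    by (auto simp: prod_emb_def PiE_iff less_Suc_eq_le)
  then have "emeasure (srw G v) {\<omega>. \<forall>i\<le>n. \<omega> i = x i} =
     emeasure (IT.CI {0..<Suc n}) (?A (Suc n))"
    unfolding srw_def using IT.lim[of "{0..<Suc n}" "?A (Suc n)"] A by simp
  also have "\<dots> = emeasure (IT.C 0 (Suc n) (\<lambda>_. undefined)) (?A (Suc n))"
    using IT.emeasure_CI[of "{0..<Suc n}" "Suc n" "?A (Suc n)"] A[of "Suc n"]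
    by (simp add: prod_emb_PiE_same_index)
  finally show ?thesis
    by (simp only: C)
qed

end

theory Submission
  imports Defs
begin

text \<open>
  Write \<open>d\<close> for the distance in a tree of order \<open>n\<close> and \<open>D(v)\<close> for the sum of all \<open>d(v, u)\<close>. Every
  \<open>v \<noteq> u\<close> has exactly one neighbour nearer to \<open>u\<close>, and all its other neighbours are farther from \<open>u\<close>.
  Hence \<open>h(v) = D(w) - D(v) + (n - 1) d(v, w)\<close> solves the first-step equations of the hitting
  time of \<open>w\<close>, and so equals it. Summing over \<open>w\<close>, the cover cost of \<open>r\<close> is the sum of \<open>D(w)\<close> over
  \<open>w \<noteq> r\<close>. Since \<open>D(w) \<ge> 2(n - 1) - deg w\<close>, with equality iff no vertex is at distance more than 2
  from \<open>w\<close>, and the degrees add up to \<open>2(n - 1)\<close>, the cover cost is at least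
  \<open>(n - 1)(2n - 4) + deg r\<close>.
\<close>

section \<open>Hitting times from the first-step equations\<close>

text \<open>One step of the walk, killed on leaving \<open>S\<close>.\<close>

definition killed_step :: "'a pair_pre_digraph \<Rightarrow> 'a set \<Rightarrow> ('a \<Rightarrow> real) \<Rightarrow> 'a \<Rightarrow> real" where
  "killed_step G S f u = (\<Sum>y\<in>S. pmf (pmf_of_set (neighbours G u)) y * f y)"

section \<open>Powers of the killed step and weighted sums over paths\<close>

lemma killed_step_cong:
  "(\<And>y. y \<in> S \<Longrightarrow> f y = g y) \<Longrightarrow> killed_step G S f u = killed_step G S g u"
  by (simp add: killed_step_def)

lemma killed_step_mono:
  "(\<And>y. y \<in> S \<Longrightarrow> f y \<le> g y) \<Longrightarrow> killed_step G S f u \<le> killed_step G S g u"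
  by (auto simp: killed_step_def intro!: sum_mono mult_left_mono)

lemma killed_step_linear:
  "killed_step G S (\<lambda>y. a * f y + g y) u = a * killed_step G S f u + killed_step G S g u"
  by (simp add: killed_step_def algebra_simps sum.distrib sum_distrib_left)

lemma killed_step_sum:
  "killed_step G S (\<lambda>y. \<Sum>t\<in>A. f t y) u = (\<Sum>t\<in>A. killed_step G S (f t) u)"
  unfolding killed_step_def sum_distrib_left by (rule sum.swap)

lemma killed_step_nonneg:
  "(\<And>y. y \<in> S \<Longrightarrow> 0 \<le> f y) \<Longrightarrow> 0 \<le> killed_step G S f u"
  by (auto simp: killed_step_def intro!: sum_nonneg)

lemma killed_step_power_nonneg:
  "(\<And>y. y \<in> S \<Longrightarrow> 0 \<le> f y) \<Longrightarrow> u \<in> S \<Longrightarrow> 0 \<le> (killed_step G S ^^ t) f u"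
  by (induction t arbitrary: u) (auto intro!: killed_step_nonneg)

lemma killed_step_power_mono:
  "(\<And>y. y \<in> S \<Longrightarrow> f y \<le> g y) \<Longrightarrow> u \<in> S \<Longrightarrow>
     (killed_step G S ^^ t) f u \<le> (killed_step G S ^^ t) g u"
  by (induction t arbitrary: u) (auto intro!: killed_step_mono)

lemma killed_step_power_cmult:
  "(killed_step G S ^^ t) (\<lambda>y. a * f y) u = a * (killed_step G S ^^ t) f u"
proof (induction t arbitrary: u)
  case (Suc t)
  then show ?case
    by (simp add: killed_step_def sum_distrib_left ac_simps)
qed simp

text \<open>Summing over the last position of a path replaces \<open>f\<close> by
  \<open>killed_step G S f\<close>, so the induction on \<open>t\<close> generalises over
  \<open>f\<close>. The indicator fixes the starting point, whence the value 0 when \<open>v\<close>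
  lies outside \<open>S\<close>.\<close>

lemma sum_paths_eq_killed_step_power:
  assumes "finite S"
  shows "(\<Sum>x\<in>PiE {..t} (\<lambda>_. S). indicator {v} (x 0) *
            (\<Prod>i<t. pmf (pmf_of_set (neighbours G (x i))) (x (Suc i))) * f (x t)) =
         (if v \<in> S then (killed_step G S ^^ t) f v else 0)"
proof (induction t arbitrary: f)
  case 0
  \<comment> \<open>A path with the single time 0 amounts to one point of \<open>S\<close>.\<close>
  have "PiE {..0::nat} (\<lambda>_. S) = (\<lambda>s. \<lambda>i\<in>{0}. s) ` S"
  proof (intro equalityI subsetI)
    fix x assume x: "x \<in> PiE {..0::nat} (\<lambda>_. S)"
    then have "x = (\<lambda>i\<in>{0}. x 0)" by (auto simp: PiE_iff extensional_def fun_eq_iff)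
    with x show "x \<in> (\<lambda>s. \<lambda>i\<in>{0}. s) ` S" by auto
  qed (auto simp: PiE_iff extensional_def)
  moreover have "inj_on (\<lambda>s. \<lambda>i\<in>{0::nat}. s) S"
    by (auto simp: inj_on_def fun_eq_iff split: if_splits)
  ultimately have "(\<Sum>x\<in>PiE {..0::nat} (\<lambda>_. S). indicator {v} (x 0) * f (x 0)) =
      (\<Sum>s\<in>S. indicator {v} s * f s)"
    by (simp only: sum.reindex) simp
  also have "\<dots> = (\<Sum>s\<in>S. if s = v then f s else 0)"
    by (intro sum.cong) auto
  also have "\<dots> = (if v \<in> S then f v else 0)" using assms by simp
  finally show ?case by simp
next
  case (Suc t)
  let ?p = "\<lambda>u. pmf (pmf_of_set (neighbours G u))"
  have ins: "{..Suc t} = insert (Suc t) {..t}" by auto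
  have "(\<Sum>x\<in>PiE {..Suc t} (\<lambda>_. S). indicator {v} (x 0) *
            (\<Prod>i<Suc t. ?p (x i) (x (Suc i))) * f (x (Suc t))) =
        (\<Sum>(y, x)\<in>S \<times> PiE {..t} (\<lambda>_. S). indicator {v} (x 0) *
            (\<Prod>i<t. ?p (x i) (x (Suc i))) * (?p (x t) y * f y))"
    unfolding ins PiE_insert_eq
    by (subst sum.reindex[OF inj_combinator])
       (auto intro!: sum.cong simp: case_prod_unfold mult.assoc intro!: prod.cong)
  also have "\<dots> = (\<Sum>x\<in>PiE {..t} (\<lambda>_. S). indicator {v} (x 0) *
            (\<Prod>i<t. ?p (x i) (x (Suc i))) * killed_step G S f (x t))"
    unfolding sum.cartesian_product[symmetric]
    by (subst sum.swap) (simp add: killed_step_def sum_distrib_left)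
  also have "\<dots> = (if v \<in> S then (killed_step G S ^^ Suc t) f v else 0)"
    by (simp only: Suc funpow_Suc_right o_apply)
  finally show ?case .
qed

section \<open>The law of the walk and the probability of staying in a finite set\<close>

lemma sets_srw [measurable_cong]: "sets (srw G v) = sets (PiM UNIV (\<lambda>_. count_space UNIV))"
proof -
  interpret IT: Ionescu_Tulcea "srw_kernel G v" "\<lambda>_. count_space UNIV"
    by (rule Ionescu_Tulcea_srw_kernel)
  show ?thesis unfolding srw_def by simp
qed

lemma space_srw [simp]: "space (srw G v) = UNIV"
  using sets_eq_imp_space_eq[OF sets_srw, of G v] by (simp add: space_PiM)

lemma sets_srw_all: "{\<omega>. \<forall>i\<le>t. P i (\<omega> i)} \<in> sets (srw G v)"
proof -
  have "{\<omega>. \<forall>i\<le>t. P i (\<omega> i)} =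
      prod_emb UNIV (\<lambda>_. count_space UNIV) {..t} (PiE {..t} (\<lambda>i. {a. P i a}))"
    by (auto simp: prod_emb_def PiE_iff)
  then show ?thesis unfolding sets_srw by (simp add: sets_PiM_I)
qed

text \<open>The cylinder over the empty index set is the whole space, so the total mass is that of
  the projection \<open>IT.CI {}\<close>.\<close>

lemma prob_space_srw: "prob_space (srw G v)"
proof -
  interpret IT: Ionescu_Tulcea "srw_kernel G v" "\<lambda>_. count_space UNIV"
    by (rule Ionescu_Tulcea_srw_kernel)
  let ?M = "\<lambda>_::nat. count_space (UNIV :: 'a set)"
  interpret C: prob_space "IT.CI {}" by (rule IT.PF.prob_space_P) auto
  have "emeasure (srw G v) (prod_emb UNIV ?M {} (space (PiM {} ?M))) = emeasure (IT.CI {}) (space (PiM {} ?M))"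
    unfolding srw_def by (rule IT.lim) auto
  also have "space (PiM {} ?M) = space (IT.CI {})"
    by (rule sets_eq_imp_space_eq) (simp add: IT.PF.sets_P)
  also have "prod_emb UNIV ?M {} (space (IT.CI {})) = UNIV"
    by (auto simp: prod_emb_def IT.PF.space_P space_PiM)
  finally show ?thesis
    by (intro prob_spaceI) (simp add: C.emeasure_space_1)
qed

text \<open>The event is a finite disjoint union of cylinders, one for each path in
  \<open>S\<close>; their masses add up to the path sum with \<open>f = 1\<close>.\<close>

lemma emeasure_srw_stay:
  assumes S: "finite S"
  shows "emeasure (srw G v) {\<omega>. \<forall>i\<le>t. \<omega> i \<in> S} =
    ennreal (if v \<in> S then (killed_step G S ^^ t) (\<lambda>_. 1) v else 0)"
proof -
  let ?cyl = "\<lambda>x. {\<omega>. \<forall>i\<le>t. \<omega> i = x i}" and ?P = "PiE {..t} (\<lambda>_. S)"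
  have un: "{\<omega>. \<forall>i\<le>t. \<omega> i \<in> S} = (\<Union>x\<in>?P. ?cyl x)"
  proof (intro equalityI subsetI)
    fix \<omega> assume "\<omega> \<in> {\<omega>. \<forall>i\<le>t. \<omega> i \<in> S}"
    then show "\<omega> \<in> (\<Union>x\<in>?P. ?cyl x)"
      by (intro UN_I[of "restrict \<omega> {..t}"]) auto
  qed (auto simp: PiE_iff)
  have disj: "disjoint_family_on ?cyl ?P"
  proof -
    have "x = y" if "x \<in> ?P" "y \<in> ?P" "\<omega> \<in> ?cyl x" "\<omega> \<in> ?cyl y" for x y \<omega>
      by (rule PiE_ext[OF that(1,2)]) (use that(3,4) in force)
    then show ?thesis unfolding disjoint_family_on_def by blast
  qed
  have meas: "?cyl x \<in> sets (srw G v)" for x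
    by (rule sets_srw_all)
  have "emeasure (srw G v) {\<omega>. \<forall>i\<le>t. \<omega> i \<in> S} = (\<Sum>x\<in>?P. emeasure (srw G v) (?cyl x))"
    unfolding un using S meas disj by (intro sum_emeasure[symmetric] finite_PiE) auto
  also have "\<dots> = (\<Sum>x\<in>?P. ennreal (indicator {v} (x 0) *
            (\<Prod>i<t. pmf (pmf_of_set (neighbours G (x i))) (x (Suc i))) * 1))"
    by (intro sum.cong refl, subst emeasure_srw_cylinder)
       (auto simp: prod_ennreal ennreal_mult'' prod_nonneg split: split_indicator)
  also have "\<dots> = ennreal (if v \<in> S then (killed_step G S ^^ t) (\<lambda>_. 1) v else 0)"
    by (subst sum_ennreal) (auto intro!: mult_nonneg_nonneg prod_nonneg
        simp: sum_paths_eq_killed_step_power[OF S, of v G t "\<lambda>_. 1", simplified])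
  finally show ?thesis .
qed

section \<open>Hitting times as sums of tail probabilities\<close>

lemma first_hit_eq_suminf:
  "first_hit w \<omega> = (\<Sum>t. indicator {\<omega>. \<forall>i\<le>t. \<omega> i \<noteq> w} \<omega>)"
proof (cases "\<exists>t. \<omega> t = w")
  case True
  define m where "m = (LEAST t. \<omega> t = w)"
  have m: "\<omega> m = w" unfolding m_def using True by (rule LeastI_ex)
  have less: "\<omega> i \<noteq> w" if "i < m" for i
    using not_less_Least that unfolding m_def by blast
  have le: "m \<le> t" if "\<omega> t = w" for t
    using that less not_le by blast
  have "first_hit w \<omega> = of_nat m"
    unfolding first_hit_def
    by (rule antisym) (auto intro!: INF_lower2[of m] INF_greatest simp: m le)
  \<comment> \<open>Exactly the terms with \<open>t < m\<close> equal 1.\<close>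
  also have "(\<Sum>t. indicator {\<omega>. \<forall>i\<le>t. \<omega> i \<noteq> w} \<omega> :: ennreal) =
      (\<Sum>t<m. indicator {\<omega>. \<forall>i\<le>t. \<omega> i \<noteq> w} \<omega>)"
    by (rule suminf_finite) (use m in \<open>auto simp: indicator_def not_less\<close>)
  then have "of_nat m = (\<Sum>t. indicator {\<omega>. \<forall>i\<le>t. \<omega> i \<noteq> w} \<omega> :: ennreal)"
    using less by (simp add: indicator_def)
  finally show ?thesis .
next
  case False
  \<comment> \<open>If \<open>w\<close> is never hit, both sides are \<open>top\<close>: the infimum
    is over the empty set and every term of the series is 1.\<close>
  have "(\<Sum>t. 1 :: ennreal) = top"
    by (simp add: suminf_eq_SUP ennreal_SUP_of_nat_eq_top)
  with False show ?thesis by (simp add: first_hit_def indicator_def)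
qed

lemma hitting_time_eq_suminf:
  "hitting_time G v w = (\<Sum>t. emeasure (srw G v) {\<omega>. \<forall>i\<le>t. \<omega> i \<noteq> w})"
proof -
  have [measurable]: "{\<omega>. \<forall>i\<le>t. \<omega> i \<noteq> w} \<in> sets (srw G v)" for t
    by (rule sets_srw_all)
  show ?thesis
    unfolding hitting_time_def first_hit_eq_suminf
    by (subst nn_integral_suminf) auto
qed

lemma killed_step_uniform:
  assumes "finite S" "neighbours G u \<noteq> {}" "finite (neighbours G u)"
  shows "killed_step G S f u = (\<Sum>y\<in>neighbours G u \<inter> S. f y) / card (neighbours G u)"
proof -
  have "killed_step G S f u =
      (\<Sum>y\<in>S. if y \<in> neighbours G u then f y / card (neighbours G u) else 0)"
    using assms unfolding killed_step_def by (intro sum.cong) auto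
  also have "\<dots> = (\<Sum>y\<in>neighbours G u \<inter> S. f y / card (neighbours G u))"
    using assms by (simp add: sum.inter_restrict Int_commute)
  finally show ?thesis by (simp add: sum_divide_distrib)
qed

text \<open>Since \<open>V\<close> is closed under neighbours, the step killed on leaving
  \<open>V\<close> loses no mass: it fixes the constant 1 on \<open>V\<close>.\<close>

lemma AE_srw_in_verts:
  assumes V: "finite V" "v \<in> V" "\<And>u. u \<in> V \<Longrightarrow> neighbours G u \<noteq> {} \<and> neighbours G u \<subseteq> V"
  shows "AE \<omega> in srw G v. \<forall>i\<le>t. \<omega> i \<in> V"
proof -
  interpret prob_space "srw G v" by (rule prob_space_srw)
  have meas: "{\<omega>. \<forall>i\<le>t. \<omega> i \<in> V} \<in> sets (srw G v)"
    by (rule sets_srw_all)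
  have one: "killed_step G V (\<lambda>_. 1) u = 1" if "u \<in> V" for u
    using V(3)[OF that] finite_subset[OF _ V(1)]
    by (subst killed_step_uniform) (auto simp: V(1) Int_absorb2)
  have "(killed_step G V ^^ t) (\<lambda>_. 1) u = 1" if "u \<in> V" for u
    using that
  proof (induction t arbitrary: u)
    case (Suc t)
    have "killed_step G V ((killed_step G V ^^ t) (\<lambda>_. 1)) u = killed_step G V (\<lambda>_. 1) u"
      by (rule killed_step_cong) (rule Suc.IH)
    with one[OF Suc.prems] show ?case by simp
  qed simp
  then have "emeasure (srw G v) {\<omega>. \<forall>i\<le>t. \<omega> i \<in> V} = 1"
    using V by (simp add: emeasure_srw_stay)
  then have "prob {\<omega>. \<forall>i\<le>t. \<omega> i \<in> V} = 1" by (simp add: measure_def)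
  then show ?thesis using prob_eq_1[OF meas] by simp
qed

text \<open>
  Iterating \<open>h = 1 + K h\<close>, with \<open>K\<close> the step killed at \<open>w\<close>, gives
  \<open>h = (\<Sum>t<m. K\<^sup>t 1) + K\<^sup>m h\<close>; here \<open>K\<^sup>t 1\<close> is the probability of not having hit \<open>w\<close> by time \<open>t\<close>, and
  the remainder vanishes because it is at most a constant times the general term of a convergent series.
\<close>

proposition hitting_time_eqI:
  fixes h :: "'a \<Rightarrow> real"
  assumes V: "finite V" "v \<in> V" "\<And>u. u \<in> V \<Longrightarrow> neighbours G u \<noteq> {} \<and> neighbours G u \<subseteq> V"
    and w: "h w = 0"
    and h_nonneg: "\<And>u. u \<in> V \<Longrightarrow> 0 \<le> h u"
    and h_step: "\<And>u. u \<in> V \<Longrightarrow> u \<noteq> w \<Longrightarrow> (\<Sum>x\<in>neighbours G u. h u - h x) = card (neighbours G u)"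
  shows "hitting_time G v w = ennreal (h v)"
proof -
  interpret prob_space "srw G v" by (rule prob_space_srw)
  define S where "S = V - {w}"
  let ?K = "killed_step G S"
  have S: "finite S" using V by (simp add: S_def)
  have tail: "emeasure (srw G v) {\<omega>. \<forall>i\<le>t. \<omega> i \<noteq> w} =
      ennreal (if v \<in> S then (?K ^^ t) (\<lambda>_. 1) v else 0)" for t
  proof -
    have [simp]: "{\<omega>. \<forall>i\<le>t. \<omega> i \<noteq> w} \<in> sets (srw G v)" "{\<omega>. \<forall>i\<le>t. \<omega> i \<in> S} \<in> sets (srw G v)"
      by (rule sets_srw_all)+
    have inV: "AE \<omega> in srw G v. \<forall>i\<le>t. \<omega> i \<in> V"
      using V by (rule AE_srw_in_verts)
    \<comment> \<open>The walk almost surely stays in \<open>V\<close>, so avoiding \<open>w\<close>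
      may be replaced by staying in the finite set \<open>S\<close>.\<close>
    have "emeasure (srw G v) {\<omega>. \<forall>i\<le>t. \<omega> i \<noteq> w} = emeasure (srw G v) {\<omega>. \<forall>i\<le>t. \<omega> i \<in> S}"
    proof (rule emeasure_eq_AE)
      show "AE \<omega> in srw G v. \<omega> \<in> {\<omega>. \<forall>i\<le>t. \<omega> i \<noteq> w} \<longleftrightarrow> \<omega> \<in> {\<omega>. \<forall>i\<le>t. \<omega> i \<in> S}"
        using inV by eventually_elim (auto simp: S_def)
    qed simp_all
    then show ?thesis by (simp add: emeasure_srw_stay[OF S])
  qed
  show ?thesis
  proof (cases "v \<in> S")
    case False
    then have "v = w" using V by (auto simp: S_def)
    with w have "h v = 0" by simp
    with False show ?thesis unfolding hitting_time_eq_suminf tail by simp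
  next
    case True
    define a where "a t = (?K ^^ t) (\<lambda>_. 1) v" for t
    have step: "h u = 1 + ?K h u" if "u \<in> S" for u
    proof -
      have u: "u \<in> V" "u \<noteq> w" using that by (auto simp: S_def)
      have fin: "finite (neighbours G u)" using V(3)[OF u(1)] finite_subset V(1) by blast
      \<comment> \<open>Killing at \<open>w\<close> costs nothing here because
        \<open>h w = 0\<close>.\<close>
      have "(\<Sum>y\<in>neighbours G u \<inter> S. h y) = (\<Sum>y\<in>neighbours G u. h y)"
        by (rule sum.mono_neutral_left) (use V(3)[OF u(1)] fin w in \<open>auto simp: S_def\<close>)
      moreover have "card (neighbours G u) > 0"
        using fin V(3)[OF u(1)] by (simp add: card_gt_0_iff)
      ultimately show ?thesis
        using h_step[OF u] V(3)[OF u(1)] fin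
        by (simp add: killed_step_uniform S sum_subtractf field_simps)
    qed
    have expand: "h u = (\<Sum>t<m. (?K ^^ t) (\<lambda>_. 1) u) + (?K ^^ m) h u" if "u \<in> S" for u m
      using that
    proof (induction m arbitrary: u)
      case (Suc m)
      \<comment> \<open>The factor 1 gives the argument the shape of
        \<open>killed_step_linear\<close>.\<close>
      have "h u = 1 + ?K (\<lambda>u. 1 * (\<Sum>t<m. (?K ^^ t) (\<lambda>_. 1) u) + (?K ^^ m) h u) u"
        using step[OF Suc.prems] killed_step_cong[of S h, OF Suc.IH] by simp
      also have "\<dots> = 1 + (\<Sum>t<m. (?K ^^ Suc t) (\<lambda>_. 1) u) + (?K ^^ Suc m) h u"
        unfolding killed_step_linear killed_step_sum by simp
      finally show ?case by (simp only: sum.lessThan_Suc_shift) simp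
    qed simp
    have a_nonneg: "0 \<le> a t" for t
      unfolding a_def by (rule killed_step_power_nonneg) (use True in auto)
    have rest_nonneg: "0 \<le> (?K ^^ m) h v" for m
      by (rule killed_step_power_nonneg) (use True h_nonneg in \<open>auto simp: S_def\<close>)
    have sum_le: "(\<Sum>t<m. a t) \<le> h v" for m
      using expand[OF True, of m] rest_nonneg[of m] by (simp add: a_def)
    have "summable a"
      by (rule summableI_nonneg_bounded[where x = "h v"]) (use a_nonneg sum_le in auto)
    then have a0: "a \<longlonglongrightarrow> 0" by (rule summable_LIMSEQ_zero)
    \<comment> \<open>On \<open>S\<close>, \<open>h\<close> is at most \<open>C\<close> times the
      constant 1, so monotonicity of the powers bounds the remainder by
      \<open>C * a m\<close>.\<close>
    define C where "C = Max (h ` V)"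
    have "(?K ^^ m) h v \<le> C * a m" for m
      unfolding a_def killed_step_power_cmult[symmetric]
      by (rule killed_step_power_mono) (use True V in \<open>auto simp: C_def S_def\<close>)
    then have "(\<lambda>m. (?K ^^ m) h v) \<longlonglongrightarrow> 0"
      by (intro tendsto_sandwich[OF _ _ tendsto_const tendsto_mult_right_zero[OF a0, of C]])
         (auto simp: rest_nonneg)
    then have "(\<lambda>m. h v - (?K ^^ m) h v) \<longlonglongrightarrow> h v - 0"
      by (intro tendsto_intros)
    moreover have "h v - (?K ^^ m) h v = (\<Sum>t<m. a t)" for m
      using expand[OF True, of m] by (simp add: a_def)
    ultimately have "a sums h v" by (simp add: sums_def)
    then have "(\<Sum>t. ennreal (a t)) = ennreal (h v)"
      using a_nonneg by (intro suminf_ennreal_eq)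
    then show ?thesis using True by (simp add: hitting_time_eq_suminf tail a_def)
  qed
qed

section \<open>Distances in trees\<close>

text \<open>Minimising over walks gives the usual graph distance, since a shortest walk repeats no
  vertex. The value is unspecified when no walk exists, which cannot happen between vertices of a
  connected graph.\<close>

definition tdist :: "'a pair_pre_digraph \<Rightarrow> 'a \<Rightarrow> 'a \<Rightarrow> nat" where
  "tdist G x y = (LEAST k. (x, y) \<in> parcs G ^^ k)"

definition total_dist :: "'a pair_pre_digraph \<Rightarrow> 'a \<Rightarrow> real" where
  "total_dist G v = (\<Sum>u\<in>pverts G. real (tdist G v u))"

lemma real_card_Diff_singleton:
  "finite A \<Longrightarrow> a \<in> A \<Longrightarrow> real (card (A - {a})) = real (card A) - 1"
  using card_Suc_Diff1[of A a] by linarith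

locale undirected_tree_graph = pair_graph G for G :: "'a pair_pre_digraph" +
  assumes connected_G: "connected (with_proj G)"
    and no_long_cycle: "\<nexists>p. cycle p \<and> 3 \<le> length p"

lemma undirected_tree_iff_locale: "undirected_tree G \<longleftrightarrow> undirected_tree_graph G"
  unfolding undirected_tree_def undirected_tree_graph_def undirected_tree_graph_axioms_def ..

context undirected_tree_graph
begin

section \<open>Adjacency and the graph metric\<close>

lemma arcs_ends_eq: "arcs_ends (with_proj G) = parcs G"
  by (auto simp: arcs_ends_def arc_to_ends_def)

lemma sym_parcs: "(x, y) \<in> parcs G \<Longrightarrow> (y, x) \<in> parcs G"
  using sym_arcs by (auto simp: symmetric_def arcs_ends_eq dest: symD)

lemma neighbours_subset: "neighbours G v \<subseteq> pverts G"
  by (auto simp: neighbours_def dest: in_arcs_imp_in_arcs_ends adj_in_verts simp: arcs_ends_eq)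

lemma finite_neighbours: "finite (neighbours G v)"
  using neighbours_subset finite_subset pair_finite_verts by blast

lemma not_self_neighbour: "v \<notin> neighbours G v"
  using no_loops by (force simp: neighbours_def)

lemma neighbours_commute: "x \<in> neighbours G y \<longleftrightarrow> y \<in> neighbours G x"
  using sym_parcs by (auto simp: neighbours_def)

lemma walk_exists:
  assumes "x \<in> pverts G" "y \<in> pverts G"
  shows "\<exists>k. (x, y) \<in> parcs G ^^ k"
proof -
  have "x \<rightarrow>\<^sup>*\<^bsub>mk_symmetric (with_proj G)\<^esub> y"
    using connected_G assms by (auto simp: connected_def strongly_connected_def)
  then have "x \<rightarrow>\<^sup>*\<^bsub>with_proj G\<^esub> y" by (simp add: reachable_mk_symmetric_eq[OF sym_arcs])
  then have "(x, y) \<in> (parcs G)\<^sup>*" using reachable_rtranclI by (metis arcs_ends_eq)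
  then show ?thesis by (simp add: rtrancl_power)
qed

lemma tdist_walk: "x \<in> pverts G \<Longrightarrow> y \<in> pverts G \<Longrightarrow> (x, y) \<in> parcs G ^^ tdist G x y"
  unfolding tdist_def using walk_exists by (rule LeastI_ex)

lemma tdist_le: "(x, y) \<in> parcs G ^^ k \<Longrightarrow> tdist G x y \<le> k"
  unfolding tdist_def by (rule Least_le)

lemma tdist_self [simp]: "tdist G x x = 0"
  using tdist_le[of x x 0] by simp

lemma tdist_eq_0_iff: "x \<in> pverts G \<Longrightarrow> y \<in> pverts G \<Longrightarrow> tdist G x y = 0 \<longleftrightarrow> x = y"
  using tdist_walk[of x y] by auto

lemma tdist_neighbour_iff:
  assumes "x \<in> pverts G" "y \<in> pverts G" "x \<noteq> y"
  shows "tdist G x y = 1 \<longleftrightarrow> y \<in> neighbours G x"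
proof
  assume "tdist G x y = 1"
  then show "y \<in> neighbours G x" using tdist_walk[of x y] assms by (simp add: neighbours_def)
next
  assume "y \<in> neighbours G x"
  then have "tdist G x y \<le> 1" by (intro tdist_le) (simp add: neighbours_def)
  with tdist_eq_0_iff[of x y] assms show "tdist G x y = 1" by linarith
qed

lemma tdist_commute: "tdist G x y = tdist G y x"
proof -
  have "sym (parcs G)" by (auto intro: symI sym_parcs)
  then have "(parcs G)\<inverse> = parcs G" by (simp add: sym_conv_converse_eq)
  then have "(parcs G ^^ k)\<inverse> = parcs G ^^ k" for k
    by (induction k) (simp_all add: converse_relcomp relpow_commute)
  then have "(x, y) \<in> parcs G ^^ k \<longleftrightarrow> (y, x) \<in> parcs G ^^ k" for k by blast
  then show ?thesis by (simp add: tdist_def)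
qed

lemma tdist_triangle:
  assumes "x \<in> pverts G" "y \<in> pverts G" "z \<in> pverts G"
  shows "tdist G x z \<le> tdist G x y + tdist G y z"
  by (rule tdist_le, unfold relpow_add)
     (rule relcompI[OF tdist_walk[OF assms(1,2)] tdist_walk[OF assms(2,3)]])

lemma tdist_step_le:
  assumes "v \<in> pverts G" "u \<in> pverts G" "x \<in> neighbours G v"
  shows "tdist G x u \<le> Suc (tdist G v u)"
proof -
  have x: "x \<in> pverts G" "x \<noteq> v" using assms(3) neighbours_subset not_self_neighbour by auto
  have "v \<in> neighbours G x" using assms(3) neighbours_commute by blast
  then have "tdist G x v = 1" using tdist_neighbour_iff[of x v] x assms by simp
  then show ?thesis using tdist_triangle[of x v u] x assms by simp
qed

text \<open>Take the second vertex of a shortest walk from \<open>v\<close> to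
  \<open>u\<close>.\<close>

lemma closer_neighbour_exists:
  assumes "v \<in> pverts G" "u \<in> pverts G" "v \<noteq> u"
  obtains x where "x \<in> neighbours G v" "tdist G v u = Suc (tdist G x u)"
proof -
  have "tdist G v u \<noteq> 0" using tdist_eq_0_iff assms by blast
  then obtain k where k: "tdist G v u = Suc k" by (cases "tdist G v u") auto
  with tdist_walk[OF assms(1,2)] have "(v, u) \<in> parcs G ^^ Suc k" by simp
  then obtain x where x: "(v, x) \<in> parcs G" "(x, u) \<in> parcs G ^^ k"
    by (rule relpow_Suc_E2)
  then have nx: "x \<in> neighbours G v" by (simp add: neighbours_def)
  have "tdist G v u \<le> Suc (tdist G x u)"
    using tdist_step_le[of x u v] nx neighbours_subset neighbours_commute[of x v] assms by blast
  moreover have "tdist G x u \<le> k" using x(2) by (rule tdist_le)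
  ultimately show ?thesis using that nx k by simp
qed

section \<open>Connectivity after deleting a vertex\<close>

definition avoiding :: "'a \<Rightarrow> ('a \<times> 'a) set" where
  "avoiding v = {(a, b) \<in> parcs G. a \<noteq> v \<and> b \<noteq> v}"

text \<open>Turns relational reachability into an arc list, the form in which cycles are
  defined.\<close>

lemma awalk_if_avoiding:
  assumes "(x, y) \<in> (avoiding v)\<^sup>*" "x \<noteq> v" "y \<in> pverts G"
  shows "\<exists>p. awalk x p y \<and> v \<notin> set (awalk_verts x p)"
  using assms
proof (induction rule: converse_rtrancl_induct)
  case base
  then show ?case by (intro exI[of _ "[]"]) (auto simp: awalk_Nil_iff)
next
  case (step x z)
  then have xz: "(x, z) \<in> parcs G" "x \<noteq> v" "z \<noteq> v" by (auto simp: avoiding_def)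
  with step obtain p where p: "awalk z p y" "v \<notin> set (awalk_verts z p)" by auto
  with xz show ?case
    by (intro exI[of _ "(x, z) # p"]) (auto simp: awalk_Cons_iff)
qed

text \<open>If \<open>x \<noteq> y\<close>, a path from \<open>x\<close> to \<open>y\<close> that avoids \<open>v\<close> closes up to a cycle through \<open>v\<close>.\<close>

lemma neighbours_separated:
  assumes xy: "x \<in> neighbours G v" "y \<in> neighbours G v" and conn: "(x, y) \<in> (avoiding v)\<^sup>*"
  shows "x = y"
proof (rule ccontr)
  assume "x \<noteq> y"
  have vx: "(v, x) \<in> parcs G" and yv: "(y, v) \<in> parcs G"
    using xy sym_parcs by (auto simp: neighbours_def)
  have V: "x \<noteq> v" "y \<in> pverts G" "v \<in> pverts G"
    using xy neighbours_subset not_self_neighbour neighbours_commute by blast+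
  obtain p where p: "awalk x p y" "v \<notin> set (awalk_verts x p)"
    using awalk_if_avoiding[OF conn V(1,2)] by blast
  \<comment> \<open>Shortcutting to a path makes the vertices distinct; it uses only arcs of
    \<open>p\<close> and therefore still avoids \<open>v\<close>.\<close>
  define q where "q = awalk_to_apath p"
  have q: "apath x q y" using apath_awalk_to_apath[OF p(1)] by (simp add: q_def)
  then have q_walk: "awalk x q y" and q_dist: "distinct (awalk_verts x q)" by (auto simp: apath_def)
  have "q \<noteq> []" using q_walk \<open>x \<noteq> y\<close> by (auto simp: awalk_Nil_iff)
  have "set q \<subseteq> set p" using awalk_to_apath_subset[OF p(1)] by (simp add: q_def)
  then have "set (awalk_verts x q) \<subseteq> set (awalk_verts x p)"
    using \<open>q \<noteq> []\<close> unfolding set_awalk_verts[OF p(1)] set_awalk_verts[OF q_walk] by auto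
  with p(2) have v: "v \<notin> set (awalk_verts x q)" by blast
  define c where "c = (v, x) # q @ [(y, v)]"
  have c: "awalk v c v"
    unfolding c_def using vx yv q_walk V
    by (auto simp: awalk_Cons_iff awalk_Nil_iff intro!: awalk_appendI)
  have "awalk_verts v c = v # awalk_verts x q @ [v]"
    using \<open>q \<noteq> []\<close> q_walk by (auto simp: c_def awalk_verts_append awalk_verts_conv)
  with q_dist v have "distinct (tl (awalk_verts v c))" by simp
  with c have "cycle c" unfolding cycle_def by (auto simp: c_def)
  \<comment> \<open>Two arcs at \<open>v\<close> and at least one in \<open>q\<close>, so
    \<open>c\<close> is not a mere step back and forth.\<close>
  moreover have "3 \<le> length c" using \<open>q \<noteq> []\<close> by (cases q) (auto simp: c_def)
  ultimately show False using no_long_cycle by blast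
qed

text \<open>Along a shortest walk from \<open>x\<close> to \<open>u\<close> the distance to
  \<open>u\<close> drops strictly below that of \<open>v\<close> after one step, so the walk never
  meets \<open>v\<close>.\<close>

lemma avoiding_connected_if_closer:
  assumes "x \<in> pverts G" "u \<in> pverts G" "x \<noteq> v" "tdist G x u \<le> tdist G v u"
  shows "(x, u) \<in> (avoiding v)\<^sup>*"
  using assms
proof (induction "tdist G x u" arbitrary: x)
  case 0
  then show ?case using tdist_eq_0_iff by auto
next
  case (Suc k)
  then have "x \<noteq> u" by auto
  then obtain z where z: "z \<in> neighbours G x" "tdist G x u = Suc (tdist G z u)"
    using closer_neighbour_exists Suc.prems by metis
  have zv: "z \<noteq> v" using z Suc.prems by auto
  have "(z, u) \<in> (avoiding v)\<^sup>*"
    by (rule Suc.hyps) (use z zv Suc neighbours_subset in auto)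
  moreover have "(x, z) \<in> avoiding v" using z(1) zv Suc.prems by (auto simp: avoiding_def neighbours_def)
  ultimately show ?case by (rule converse_rtrancl_into_rtrancl[rotated])
qed

text \<open>Both neighbours reach \<open>u\<close> without passing \<open>v\<close>, hence reach
  each other that way. The weak inequalities matter: once a strictly closer neighbour is known, they
  exclude a second one at the same distance as \<open>v\<close>.\<close>

lemma closer_neighbour_unique:
  assumes u: "u \<in> pverts G" and x: "x \<in> neighbours G v" "tdist G x u \<le> tdist G v u"
    and y: "y \<in> neighbours G v" "tdist G y u \<le> tdist G v u"
  shows "x = y"
proof -
  have *: "(z, u) \<in> (avoiding v)\<^sup>*" if "z \<in> neighbours G v" "tdist G z u \<le> tdist G v u" for z
    by (rule avoiding_connected_if_closer) (use that u neighbours_subset not_self_neighbour in auto)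
  have "sym (avoiding v)" using sym_parcs by (auto simp: avoiding_def sym_def)
  then have "sym ((avoiding v)\<^sup>*)" by (rule sym_rtrancl)
  then have "(u, y) \<in> (avoiding v)\<^sup>*" using *[OF y] by (rule symD)
  with *[OF x] have "(x, y) \<in> (avoiding v)\<^sup>*" by simp
  then show ?thesis using neighbours_separated x y by blast
qed

section \<open>Sums of distance increments over neighbours\<close>

lemma sum_neighbours_tdist:
  assumes "v \<in> pverts G" "u \<in> pverts G"
  shows "(\<Sum>x\<in>neighbours G v. real (tdist G x u) - real (tdist G v u)) =
    real (card (neighbours G v)) - (if u = v then 0 else 2)"
proof (cases "u = v")
  case True
  have "tdist G x v = 1" if "x \<in> neighbours G v" for x
    using tdist_neighbour_iff[of x v] that assms neighbours_subset not_self_neighbour neighbours_commute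
    by blast
  with True show ?thesis by simp
next
  case False
  then obtain p where p: "p \<in> neighbours G v" "tdist G v u = Suc (tdist G p u)"
    using closer_neighbour_exists assms by metis
  \<comment> \<open>The neighbour \<open>p\<close> contributes -1 and each of the others +1, which
    explains the correction by 2.\<close>
  have "real (tdist G x u) - real (tdist G v u) = 1" if "x \<in> neighbours G v - {p}" for x
    using closer_neighbour_unique[OF assms(2), of x v p] tdist_step_le[OF assms, of x] that p
    by fastforce
  then have "(\<Sum>x\<in>neighbours G v - {p}. real (tdist G x u) - real (tdist G v u)) =
      real (card (neighbours G v - {p}))" by simp
  then have "(\<Sum>x\<in>neighbours G v. real (tdist G x u) - real (tdist G v u)) =
      (real (tdist G p u) - real (tdist G v u)) + real (card (neighbours G v - {p}))"
    by (simp only: sum.remove[OF finite_neighbours p(1)])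
  then show ?thesis
    using False by (simp add: p(2) real_card_Diff_singleton[OF finite_neighbours p(1)])
qed

lemma verts_nonempty: "pverts G \<noteq> {}"
  using connected_G by (auto simp: connected_def strongly_connected_def)

text \<open>Summed over all arcs, the increments of the distance to a fixed vertex cancel.\<close>

lemma sum_degrees: "(\<Sum>v\<in>pverts G. real (card (neighbours G v))) = 2 * (real (card (pverts G)) - 1)"
proof -
  obtain u where u: "u \<in> pverts G" using verts_nonempty by auto
  \<comment> \<open>Extension by 0 lets both sums range over \<open>pverts G\<close>, so they can be
    swapped; \<open>?f\<close> is antisymmetric.\<close>
  let ?f = "\<lambda>v x. if x \<in> neighbours G v then real (tdist G x u) - real (tdist G v u) else 0"
  let ?S = "\<Sum>v\<in>pverts G. \<Sum>x\<in>pverts G. ?f v x"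
  have "?S = (\<Sum>x\<in>pverts G. \<Sum>v\<in>pverts G. ?f v x)" by (rule sum.swap)
  also have "\<dots> = (\<Sum>x\<in>pverts G. \<Sum>v\<in>pverts G. - ?f x v)"
    by (intro sum.cong refl) (auto simp: neighbours_commute)
  also have "\<dots> = - ?S" by (simp only: sum_negf)
  finally have "?S = 0" by simp
  moreover have "?S = (\<Sum>v\<in>pverts G. real (card (neighbours G v)) - (if u = v then 0 else 2))"
  proof (rule sum.cong[OF refl])
    fix v assume v: "v \<in> pverts G"
    have "(\<Sum>x\<in>pverts G. ?f v x) = (\<Sum>x\<in>neighbours G v. real (tdist G x u) - real (tdist G v u))"
      using neighbours_subset by (simp add: sum.inter_restrict[symmetric] pair_finite_verts Int_absorb1)
    with sum_neighbours_tdist[OF v u]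
    show "(\<Sum>x\<in>pverts G. ?f v x) = real (card (neighbours G v)) - (if u = v then 0 else 2)" by simp
  qed
  moreover have "(\<Sum>v\<in>pverts G. if u = v then 0 else 2 :: real) = 2 * (real (card (pverts G)) - 1)"
  proof -
    have "(\<Sum>v\<in>pverts G - {u}. if u = v then 0 else 2 :: real) = (\<Sum>v\<in>pverts G - {u}. 2)"
      by (intro sum.cong) auto
    then show ?thesis
      by (simp add: sum.remove[OF pair_finite_verts u] real_card_Diff_singleton[OF pair_finite_verts u])
  qed
  ultimately show ?thesis by (simp add: sum_subtractf)
qed

lemma sum_neighbours_total_dist:
  assumes "v \<in> pverts G"
  shows "(\<Sum>x\<in>neighbours G v. total_dist G x - total_dist G v) =
    real (card (neighbours G v)) + (real (card (pverts G)) - 1) * (real (card (neighbours G v)) - 2)"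
proof -
  let ?d = "real (card (neighbours G v))"
  have "(\<Sum>x\<in>neighbours G v. total_dist G x - total_dist G v) =
      (\<Sum>u\<in>pverts G. \<Sum>x\<in>neighbours G v. real (tdist G x u) - real (tdist G v u))"
    unfolding total_dist_def sum_subtractf[symmetric] by (rule sum.swap)
  also have "\<dots> = (\<Sum>u\<in>pverts G. ?d - (if u = v then 0 else 2))"
    by (intro sum.cong refl) (simp add: sum_neighbours_tdist assms)
  also have "\<dots> = ?d + (real (card (pverts G)) - 1) * (?d - 2)"
    by (simp add: sum.remove[OF pair_finite_verts assms] real_card_Diff_singleton[OF pair_finite_verts assms])
  finally show ?thesis .
qed

section \<open>Hitting times and cover cost in a tree\<close>

lemma neighbours_nonempty:
  assumes "2 \<le> card (pverts G)" "v \<in> pverts G"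
  shows "neighbours G v \<noteq> {}"
proof -
  have "pverts G \<noteq> {v}" using assms by auto
  then obtain u where "u \<in> pverts G" "v \<noteq> u" using assms by blast
  then show ?thesis using closer_neighbour_exists assms by blast
qed

lemma tree_potential_nonneg:
  assumes u: "u \<in> pverts G" and w: "w \<in> pverts G"
  shows "0 \<le> total_dist G w - total_dist G u + (real (card (pverts G)) - 1) * real (tdist G u w)"
proof -
  have "total_dist G u - total_dist G w = (\<Sum>y\<in>pverts G. real (tdist G u y) - real (tdist G w y))"
    by (simp add: total_dist_def sum_subtractf)
  \<comment> \<open>The term \<open>y = u\<close> is not positive; dropping it before the triangle
    inequality gives the factor \<open>n - 1\<close> rather than \<open>n\<close>.\<close>
  also have "\<dots> \<le> (\<Sum>y\<in>pverts G - {u}. real (tdist G u y) - real (tdist G w y))"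
    using u by (simp add: sum.remove[OF pair_finite_verts u])
  also have "\<dots> \<le> (\<Sum>y\<in>pverts G - {u}. real (tdist G u w))"
  proof (rule sum_mono)
    fix y assume "y \<in> pverts G - {u}"
    then show "real (tdist G u y) - real (tdist G w y) \<le> real (tdist G u w)"
      using tdist_triangle[of u w y] u w by simp
  qed
  also have "\<dots> = (real (card (pverts G)) - 1) * real (tdist G u w)"
    by (simp add: real_card_Diff_singleton[OF pair_finite_verts u])
  finally show ?thesis by simp
qed

theorem hitting_time_tree:
  assumes n: "2 \<le> card (pverts G)" and v: "v \<in> pverts G" and w: "w \<in> pverts G"
  shows "hitting_time G v w = ennreal (total_dist G w - total_dist G v +
    (real (card (pverts G)) - 1) * real (tdist G v w))"
proof (rule hitting_time_eqI[where V = "pverts G" and h = "\<lambda>v. total_dist G w - total_dist G v +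
      (real (card (pverts G)) - 1) * real (tdist G v w)"])
  let ?h = "\<lambda>v. total_dist G w - total_dist G v + (real (card (pverts G)) - 1) * real (tdist G v w)"
  show "0 \<le> ?h u" if "u \<in> pverts G" for u using that w by (rule tree_potential_nonneg)
  show "(\<Sum>x\<in>neighbours G u. ?h u - ?h x) = card (neighbours G u)" if u: "u \<in> pverts G" "u \<noteq> w" for u
  proof -
    have "(\<Sum>x\<in>neighbours G u. ?h u - ?h x) =
       (\<Sum>x\<in>neighbours G u. (total_dist G x - total_dist G u) -
          (real (card (pverts G)) - 1) * (real (tdist G x w) - real (tdist G u w)))"
      by (intro sum.cong refl) (simp add: algebra_simps)
    also have "\<dots> = (\<Sum>x\<in>neighbours G u. total_dist G x - total_dist G u) -
       (real (card (pverts G)) - 1) * (\<Sum>x\<in>neighbours G u. real (tdist G x w) - real (tdist G u w))"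
      by (simp only: sum_subtractf[of _ "\<lambda>x. (real (card (pverts G)) - 1) * _ x"] sum_distrib_left)
    \<comment> \<open>With \<open>d\<close> the degree of \<open>u\<close>, the two sums are
      \<open>d + (n - 1) * (d - 2)\<close> and, because \<open>u \<noteq> w\<close>,
      \<open>d - 2\<close>.\<close>
    also have "\<dots> = card (neighbours G u)"
      using u w by (simp add: sum_neighbours_total_dist sum_neighbours_tdist del: sum_subtractf)
    finally show ?thesis .
  qed
qed (use n v neighbours_nonempty neighbours_subset pair_finite_verts in auto)

theorem cover_cost_tree:
  assumes n: "2 \<le> card (pverts G)" and r: "r \<in> pverts G"
  shows "cover_cost G r = ennreal (\<Sum>w\<in>pverts G - {r}. total_dist G w)"
proof -
  have "cover_cost G r = ennreal (\<Sum>w\<in>pverts G. total_dist G w - total_dist G r +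
      (real (card (pverts G)) - 1) * real (tdist G r w))"
    unfolding cover_cost_def
    by (subst sum_ennreal[symmetric]) (auto simp: hitting_time_tree n r tree_potential_nonneg)
  also have "(\<Sum>w\<in>pverts G. total_dist G w - total_dist G r +
      (real (card (pverts G)) - 1) * real (tdist G r w)) =
      (\<Sum>w\<in>pverts G. total_dist G w) - real (card (pverts G)) * total_dist G r +
      (real (card (pverts G)) - 1) * total_dist G r"
    by (simp add: sum.distrib sum_subtractf sum_distrib_left[symmetric] total_dist_def[of G r])
  \<comment> \<open>The coefficients \<open>-n\<close> and \<open>n - 1\<close> leave one negative
    copy of \<open>total_dist G r\<close>, which cancels the term \<open>w = r\<close>.\<close>
  also have "\<dots> = (\<Sum>w\<in>pverts G - {r}. total_dist G w)"
    by (simp add: sum.remove[OF pair_finite_verts r] algebra_simps)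
  finally show ?thesis .
qed

section \<open>Bounds for total distances, with the equality case\<close>

lemma sum_two_minus_adjacency:
  assumes "w \<in> pverts G"
  shows "(\<Sum>u\<in>pverts G - {w}. 2 - (if u \<in> neighbours G w then 1 else 0 :: real)) =
    2 * (real (card (pverts G)) - 1) - real (card (neighbours G w))"
proof -
  have "(pverts G - {w}) \<inter> neighbours G w = neighbours G w"
    using neighbours_subset not_self_neighbour by blast
  then show ?thesis
    by (simp add: sum_subtractf sum.inter_restrict[symmetric] pair_finite_verts real_card_Diff_singleton[OF pair_finite_verts assms])
qed

text \<open>Each \<open>u \<noteq> w\<close> is charged the least distance that adjacency permits: 1
  for a neighbour of \<open>w\<close>, 2 otherwise.\<close>

lemma total_dist_ge:
  assumes w: "w \<in> pverts G"
  shows "2 * (real (card (pverts G)) - 1) - real (card (neighbours G w)) \<le> total_dist G w"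
proof -
  have "2 - (if u \<in> neighbours G w then 1 else 0) \<le> real (tdist G w u)" if u: "u \<in> pverts G - {w}" for u
    using tdist_neighbour_iff[of w u] tdist_eq_0_iff[of w u] u w
    \<comment> \<open>The cases amount to distance 0, 1 and at least 2.\<close>
    by (cases "tdist G w u"; cases "tdist G w u - 1") auto
  then show ?thesis
    unfolding sum_two_minus_adjacency[OF w, symmetric] total_dist_def
    by (simp only: sum.remove[OF pair_finite_verts w] tdist_self of_nat_0 add_0_left) (rule sum_mono)
qed

lemma total_dist_eq:
  assumes w: "w \<in> pverts G" and diam: "\<And>u. u \<in> pverts G \<Longrightarrow> tdist G w u \<le> 2"
  shows "total_dist G w = 2 * (real (card (pverts G)) - 1) - real (card (neighbours G w))"
proof -
  have "2 - (if u \<in> neighbours G w then 1 else 0) = real (tdist G w u)" if u: "u \<in> pverts G - {w}" for u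
    using tdist_neighbour_iff[of w u] tdist_eq_0_iff[of w u] u w diam[of u]
    by (cases "tdist G w u"; cases "tdist G w u - 1") auto
  then show ?thesis
    unfolding sum_two_minus_adjacency[OF w, symmetric] total_dist_def
    by (simp add: sum.remove[OF pair_finite_verts w])
qed

text \<open>The degrees other than that of \<open>r\<close> add up to
  \<open>2 * (n - 1) - deg r\<close>, and
  \<open>2 * (n - 1)^2 - 2 * (n - 1) = 2 * n^2 - 6 * n + 4\<close>.\<close>

lemma sum_total_dist_bound:
  assumes r: "r \<in> pverts G"
  shows "(\<Sum>w\<in>pverts G - {r}. 2 * (real (card (pverts G)) - 1) - real (card (neighbours G w))) =
    (2 * real (card (pverts G)) ^ 2 - 6 * real (card (pverts G)) + 4) + real (card (neighbours G r))"
proof -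
  have degs: "(\<Sum>w\<in>pverts G - {r}. real (card (neighbours G w))) =
      2 * (real (card (pverts G)) - 1) - real (card (neighbours G r))"
    using sum_degrees by (simp add: sum.remove[OF pair_finite_verts r])
  have card: "real (card (pverts G - {r})) = real (card (pverts G)) - 1"
    by (simp add: real_card_Diff_singleton[OF pair_finite_verts r])
  show ?thesis
    unfolding sum_subtractf sum_constant degs card by (simp add: power2_eq_square algebra_simps)
qed

lemma cover_cost_ge:
  assumes n: "2 \<le> card (pverts G)" and r: "r \<in> pverts G"
  shows "ennreal (2 * real (card (pverts G)) ^ 2 - 6 * real (card (pverts G)) + 5) \<le> cover_cost G r"
proof -
  \<comment> \<open>A degree of at least 1 raises the constant 4 to 5.\<close>
  have "1 \<le> card (neighbours G r)"
    using neighbours_nonempty[OF n r] finite_neighbours by (simp add: Suc_le_eq card_gt_0_iff)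
  then have "2 * real (card (pverts G)) ^ 2 - 6 * real (card (pverts G)) + 5 \<le>
      (\<Sum>w\<in>pverts G - {r}. 2 * (real (card (pverts G)) - 1) - real (card (neighbours G w)))"
    unfolding sum_total_dist_bound[OF r] by simp
  also have "\<dots> \<le> (\<Sum>w\<in>pverts G - {r}. total_dist G w)"
    by (intro sum_mono total_dist_ge) auto
  finally show ?thesis unfolding cover_cost_tree[OF assms] by (rule ennreal_leI)
qed

lemma cover_cost_leaf_diameter_2:
  assumes n: "2 \<le> card (pverts G)" and r: "r \<in> pverts G" and deg: "card (neighbours G r) = 1"
    and diam: "\<And>v u. v \<in> pverts G \<Longrightarrow> u \<in> pverts G \<Longrightarrow> tdist G v u \<le> 2"
  shows "cover_cost G r = ennreal (2 * real (card (pverts G)) ^ 2 - 6 * real (card (pverts G)) + 5)"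
proof -
  have "(\<Sum>w\<in>pverts G - {r}. total_dist G w) =
      (\<Sum>w\<in>pverts G - {r}. 2 * (real (card (pverts G)) - 1) - real (card (neighbours G w)))"
    by (intro sum.cong refl total_dist_eq) (auto simp: diam)
  then show ?thesis
    unfolding cover_cost_tree[OF n r] sum_total_dist_bound[OF r] by (simp add: deg add.commute)
qed

end

section \<open>Stars\<close>

lemma star_undirected_tree:
  assumes "star G"
  shows "undirected_tree G"
proof -
  obtain c where fin: "finite (pverts G)" and c: "c \<in> pverts G"
    and E: "parcs G = {c} \<times> (pverts G - {c}) \<union> (pverts G - {c}) \<times> {c}"
    using assms by (auto simp: star_def)
  interpret pair_graph G
    by unfold_locales (use fin c in \<open>auto simp: E symmetric_def arcs_ends_def arc_to_ends_def sym_def\<close>)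
  have to_c: "v \<rightarrow>\<^sup>*\<^bsub>with_proj G\<^esub> c" if "v \<in> pverts G" for v
  proof (cases "v = c")
    case False
    with that have "(v, c) \<in> parcs G" by (simp add: E)
    then show ?thesis by (intro reachable_adjI) (force simp: arcs_ends_def arc_to_ends_def)
  qed (use c in auto)
  then have from_c: "c \<rightarrow>\<^sup>*\<^bsub>with_proj G\<^esub> v" if "v \<in> pverts G" for v
    using symmetric_reachable[OF sym_arcs] that by blast
  have "connected (with_proj G)"
    unfolding connected_def strongly_connected_def
    using c reachable_trans[OF to_c from_c] by (auto simp: reachable_mk_symmetric_eq[OF sym_arcs])
  \<comment> \<open>Every arc has exactly one end at \<open>c\<close>. So the first and third arcs
    of the cycle both start at \<open>c\<close> or both end there, against distinctness of its
    vertices.\<close>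
  moreover have "\<not> 3 \<le> length p" if "cycle p" for p
  proof
    assume "3 \<le> length p"
    then obtain e1 e2 e3 p' where p: "p = e1 # e2 # e3 # p'"
      by (auto simp: numeral_3_eq_3 Suc_le_length_iff)
    from that obtain u where u: "awalk u p u" "distinct (tl (awalk_verts u p))"
      by (auto simp: cycle_def)
    have arcs: "e1 \<in> parcs G" "e2 \<in> parcs G" "e3 \<in> parcs G" "snd e1 = fst e2" "snd e2 = fst e3" "u = fst e1"
      using u(1) by (simp_all add: p awalk_Cons_iff)
    have p': "awalk (snd e3) p' u" using u(1) by (auto simp: p awalk_Cons_iff)
    have distinct: "distinct (fst e2 # fst e3 # awalk_verts (snd e3) p')"
      using u(2) by (simp add: p)
    have "last (awalk_verts (snd e3) p') = u" using p' by (rule awalkE)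
    then have "u \<in> set (awalk_verts (snd e3) p')"
      using last_in_set[OF awalk_verts_non_Nil] by metis
    moreover have "snd e3 \<in> set (awalk_verts (snd e3) p')" using p' by (rule hd_in_awalk_verts)
    ultimately have "fst e1 \<noteq> fst e3" "snd e1 \<noteq> snd e3"
      using arcs distinct by auto
    with arcs show False by (auto simp: E)
  qed
  ultimately show ?thesis unfolding undirected_tree_def using pair_graph by blast
qed

text \<open>Go through the centre.\<close>

lemma star_tdist_le_2:
  assumes "star G" "v \<in> pverts G" "u \<in> pverts G"
  shows "tdist G v u \<le> 2"
proof -
  interpret undirected_tree_graph G
    using star_undirected_tree[OF assms(1)] by (simp add: undirected_tree_iff_locale)
  obtain c where c: "c \<in> pverts G"
    and E: "parcs G = {c} \<times> (pverts G - {c}) \<union> (pverts G - {c}) \<times> {c}"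
    using assms by (auto simp: star_def)
  have *: "tdist G x c \<le> 1" if "x \<in> pverts G" for x
  proof (cases "x = c")
    case False
    then show ?thesis using that by (intro tdist_le) (simp add: E)
  qed simp
  show ?thesis
    using tdist_triangle[OF assms(2) c assms(3)] *[OF assms(2)] *[OF assms(3)] tdist_commute[of u c]
    by simp
qed

lemma out_degree_eq_card_neighbours: "out_degree (with_proj G) v = card (neighbours G v)"
proof -
  have "out_arcs (with_proj G) v = Pair v ` neighbours G v"
    by (auto simp: out_arcs_def neighbours_def)
  then show ?thesis by (simp add: out_degree_def card_image inj_on_def)
qed

lemma cover_cost_star_leaf:
  assumes "star G" "leaf G r" "2 \<le> card (pverts G)"
  shows "cover_cost G r = ennreal (2 * real (card (pverts G)) ^ 2 - 6 * real (card (pverts G)) + 5)"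
proof -
  interpret undirected_tree_graph G
    using star_undirected_tree[OF assms(1)] by (simp add: undirected_tree_iff_locale)
  show ?thesis
    by (rule cover_cost_leaf_diameter_2)
       (use assms in \<open>auto simp: leaf_def out_degree_eq_card_neighbours star_tdist_le_2\<close>)
qed

lemma star_leaf_exists:
  assumes "2 \<le> n"
  obtains G :: "nat pair_pre_digraph" and r where "star G" "leaf G r" "card (pverts G) = n"
proof
  \<comment> \<open>The star with centre 0; the vertex 1 exists because \<open>2 \<le> n\<close>,
    and it is a leaf.\<close>
  let ?G = "\<lparr>pverts = {..<n}, parcs = {0} \<times> ({..<n} - {0}) \<union> ({..<n} - {0}) \<times> {0}\<rparr>"
  show "star ?G" using assms by (auto simp: star_def intro!: bexI[of _ 0])
  have "neighbours ?G 1 = {0}" using assms by (auto simp: neighbours_def)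
  then show "leaf ?G 1" using assms by (simp add: leaf_def out_degree_eq_card_neighbours)
  show "card (pverts ?G) = n" by simp
qed

text \<open>The bound and its attainment hold over any vertex type; existence is stated over
  \<open>nat\<close>, because \<open>'a\<close> may have fewer than \<open>n\<close>
  elements.\<close>

theorem theorem13:
  fixes n :: nat
  assumes "n \<ge> 2"
  shows "(\<forall>(T :: 'a pair_pre_digraph) r.
            undirected_tree T \<and> card (pverts T) = n \<and> r \<in> pverts T \<longrightarrow>
            ennreal (2 * real n ^ 2 - 6 * real n + 5) \<le> cover_cost T r)
       \<and> (\<forall>(T :: 'a pair_pre_digraph) r.
            star T \<and> card (pverts T) = n \<and> leaf T r \<longrightarrow>
            undirected_tree T \<and> cover_cost T r = ennreal (2 * real n ^ 2 - 6 * real n + 5))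
       \<and> (\<exists>(T :: nat pair_pre_digraph) r.
            undirected_tree T \<and> card (pverts T) = n \<and> star T \<and> leaf T r \<and>
            cover_cost T r = ennreal (2 * real n ^ 2 - 6 * real n + 5))"
proof (intro conjI allI impI)
  fix T :: "'a pair_pre_digraph" and r
  assume "undirected_tree T \<and> card (pverts T) = n \<and> r \<in> pverts T"
  then show "ennreal (2 * real n ^ 2 - 6 * real n + 5) \<le> cover_cost T r"
    using undirected_tree_graph.cover_cost_ge[of T r] assms by (auto simp: undirected_tree_iff_locale)
next
  fix T :: "'a pair_pre_digraph" and r
  assume "star T \<and> card (pverts T) = n \<and> leaf T r"
  then show "undirected_tree T" "cover_cost T r = ennreal (2 * real n ^ 2 - 6 * real n + 5)"
    using star_undirected_tree cover_cost_star_leaf[of T r] assms by auto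
next
  obtain T :: "nat pair_pre_digraph" and r where "star T" "leaf T r" "card (pverts T) = n"
    using star_leaf_exists assms by blast
  then show "\<exists>(T :: nat pair_pre_digraph) r.
      undirected_tree T \<and> card (pverts T) = n \<and> star T \<and> leaf T r \<and>
      cover_cost T r = ennreal (2 * real n ^ 2 - 6 * real n + 5)"
    using star_undirected_tree cover_cost_star_leaf[of T r] assms by blast
qed

end
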